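(* Let $\Lambda_1$ be a quantum channel from system $A$ to system $A'$ and $\Lambda_2$ a quantum channel from system $B$ to system $B'$ (all systems finite-dimensional), and let $C$ be the Choi matrix of $\Lambda_1\otimes\Lambda_2$, acting on $ABA'B'$. For a bipartite state $\rho$, let $\tilde N(\rho)$ denote the minimal eigenvalue of the partial transpose of $\rho$. Then $$\min_{|\psi\rangle^{AB}}\tilde N\big((\Lambda_1\otimes\Lambda_2)(|\psi\rangle\langle\psi|^{AB})\big)\;\ge\;\min_{X}\operatorname{Tr}\big(X^{ABA'B'}\,C^{T_{B'}}\big),$$ where the minimum on the left is over all pure states $|\psi\rangle$ (unit vectors) of $AB$, and the minimum on the right is over all density matrices $X$ on $ABA'B'$ (i.e. $X\ge 0$, $\operatorname{Tr}X=1$) satisfying $X^{T_{A'B'}}\ge 0$.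
   Context: A quantum channel is a completely positive trace-preserving linear map. The Choi matrix $C$ of a channel $\Lambda$ from $AB$ to $A'B'$ is $C=\sum_{i,j}|i\rangle\langle j|\otimes\Lambda(|i\rangle\langle j|)$ for a fixed orthonormal product basis $\{|i\rangle\}$ of $AB$, so that $\Lambda(\rho)=\operatorname{Tr}_{AB}\big((\rho^T\otimes I^{A'B'})\,C\big)$. For a set $S$ of subsystems, $Y^{T_S}$ denotes the partial transpose of $Y$ on the subsystems in $S$ (in the fixed product basis). For a state on $A'B'$ the partial transpose in the definition of $\tilde N$ is taken on $B'$ (its spectrum is the same if taken on $A'$). *)

theory Defs
  imports "HOL-Analysis.Analysis"
begin

text \<open>
  A finite-dimensional system is given by a finite index type, whose elements label the fixed
  orthonormal basis: operators on it have type \<open>complex^'n^'n\<close>, and \<open>M $ i $ j\<close> is the entry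
  in row \<open>i\<close> and column \<open>j\<close>. A product type labels the product basis of a composite system.
\<close>

definition scale_mat :: "complex \<Rightarrow> complex^'n^'m \<Rightarrow> complex^'n^'m" where
  "scale_mat c M = map_matrix (\<lambda>x. c * x) M"

text \<open>Conjugate-linear in the first argument.\<close>

definition cinner :: "complex^'n \<Rightarrow> complex^'n \<Rightarrow> complex" where
  "cinner v w = (\<Sum>i\<in>UNIV. cnj (v $ i) * w $ i)"

text \<open>
  \<open>\<real>\<^sub>\<ge>\<^sub>0\<close> is the set of complex numbers that are real and nonnegative. Over the complex field
  this condition on the quadratic form forces \<open>M\<close> to be Hermitian.
\<close>

definition psd :: "complex^'n^'n \<Rightarrow> bool" where
  "psd M \<longleftrightarrow> (\<forall>v. cinner v (M *v v) \<in> \<real>\<^sub>\<ge>\<^sub>0)"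

definition density_matrix :: "complex^'n^'n \<Rightarrow> bool" where
  "density_matrix M \<longleftrightarrow> psd M \<and> trace M = 1"

definition pure_state :: "complex^'n \<Rightarrow> complex^'n^'n" where
  "pure_state \<psi> = (\<chi> i j. \<psi> $ i * cnj (\<psi> $ j))"

text \<open>
  The ancilla dimension \<open>n\<close> in complete positivity has to be quantified inside the definition, so
  an operator on the composite of an \<open>n\<close>-dimensional ancilla with a system is written as an
  \<open>n\<close> by \<open>n\<close> block matrix, and a vector as an \<open>n\<close>-tuple of vectors. Applying \<open>\<Lambda>\<close> to every block is
  the identity of the ancilla tensored with \<open>\<Lambda>\<close>.
\<close>

definition block_psd :: "nat \<Rightarrow> (nat \<Rightarrow> nat \<Rightarrow> complex^'n^'n) \<Rightarrow> bool" where
  "block_psd n X \<longleftrightarrow>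
    (\<forall>v :: nat \<Rightarrow> complex^'n. (\<Sum>i<n. \<Sum>j<n. cinner (v i) (X i j *v v j)) \<in> \<real>\<^sub>\<ge>\<^sub>0)"

definition completely_positive :: "(complex^'n^'n \<Rightarrow> complex^'m^'m) \<Rightarrow> bool" where
  "completely_positive \<Lambda> \<longleftrightarrow>
    (\<forall>n X. block_psd n X \<longrightarrow> block_psd n (\<lambda>i j. \<Lambda> (X i j)))"

definition quantum_channel :: "(complex^'n^'n \<Rightarrow> complex^'m^'m) \<Rightarrow> bool" where
  "quantum_channel \<Lambda> \<longleftrightarrow>
    Vector_Spaces.linear scale_mat scale_mat \<Lambda> \<and>
    completely_positive \<Lambda> \<and>
    (\<forall>M. trace (\<Lambda> M) = trace M)"

definition kron :: "complex^'n^'n \<Rightarrow> complex^'m^'m \<Rightarrow> complex^('n \<times> 'm)^('n \<times> 'm)" where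
  "kron M N = (\<chi> p q. M $ fst p $ fst q * N $ snd p $ snd q)"

definition matrix_unit :: "'n \<Rightarrow> 'n \<Rightarrow> complex^'n^'n" where
  "matrix_unit i j = (\<chi> k l. if k = i \<and> l = j then 1 else 0)"

text \<open>
  The tensor product of two linear maps on operators, given by its values on the matrix units of
  the product basis; \<open>linear_tensor_map\<close> and \<open>tensor_map_kron\<close> below are its characteristic
  properties.
\<close>

definition tensor_map ::
  "(complex^'a^'a \<Rightarrow> complex^'c^'c) \<Rightarrow> (complex^'b^'b \<Rightarrow> complex^'d^'d) \<Rightarrow>
    complex^('a \<times> 'b)^('a \<times> 'b) \<Rightarrow> complex^('c \<times> 'd)^('c \<times> 'd)" where
  "tensor_map \<Lambda>\<^sub>1 \<Lambda>\<^sub>2 M =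
    (\<Sum>p\<in>UNIV. \<Sum>q\<in>UNIV. scale_mat (M $ p $ q)
      (kron (\<Lambda>\<^sub>1 (matrix_unit (fst p) (fst q))) (\<Lambda>\<^sub>2 (matrix_unit (snd p) (snd q)))))"

definition choi :: "(complex^'n^'n \<Rightarrow> complex^'m^'m) \<Rightarrow> complex^('n \<times> 'm)^('n \<times> 'm)" where
  "choi \<Lambda> = (\<Sum>i\<in>UNIV. \<Sum>j\<in>UNIV. kron (matrix_unit i j) (\<Lambda> (matrix_unit i j)))"

text \<open>Partial transpose on the second factor of a bipartite system.\<close>

definition ptranspose ::
  "complex^('n::finite \<times> 'm::finite)^('n \<times> 'm) \<Rightarrow> complex^('n \<times> 'm)^('n \<times> 'm)" where
  "ptranspose M = (\<chi> p q. M $ (fst p, snd q) $ (fst q, snd p))"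

text \<open>
  Partial transpose on the last factor of a system whose second factor is itself bipartite; for
  \<open>ABA'B'\<close>, grouped as \<open>(AB)(A'B')\<close>, this transposes \<open>B'\<close>.
\<close>

definition ptranspose_last ::
  "complex^('n::finite \<times> ('c::finite \<times> 'd::finite))^('n \<times> ('c \<times> 'd)) \<Rightarrow>
    complex^('n \<times> ('c \<times> 'd))^('n \<times> ('c \<times> 'd))" where
  "ptranspose_last M =
    (\<chi> p q. M $ (fst p, (fst (snd p), snd (snd q))) $ (fst q, (fst (snd q), snd (snd p))))"

text \<open>
  Only used for Hermitian matrices, where every eigenvalue is real and the set below is finite and
  nonempty.
\<close>

definition min_eigenvalue :: "complex^'n^'n \<Rightarrow> real" where
  "min_eigenvalue M = Min {x. \<exists>v. v \<noteq> 0 \<and> M *v v = complex_of_real x *s v}"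

definition Ntilde :: "complex^('n::finite \<times> 'm::finite)^('n \<times> 'm) \<Rightarrow> real" where
  "Ntilde \<rho> = min_eigenvalue (ptranspose \<rho>)"

lemma vector_space_scale_mat: "vector_space scale_mat"
  by unfold_locales (simp_all add: scale_mat_def vec_eq_iff algebra_simps)

lemma linear_tensor_map:
  fixes \<Lambda>\<^sub>1 :: "complex^'a^'a \<Rightarrow> complex^'c^'c" and \<Lambda>\<^sub>2 :: "complex^'b^'b \<Rightarrow> complex^'d^'d"
  shows "Vector_Spaces.linear scale_mat scale_mat (tensor_map \<Lambda>\<^sub>1 \<Lambda>\<^sub>2)"
  unfolding Vector_Spaces.linear_iff
  by (simp add: vector_space_scale_mat)
    (simp add: tensor_map_def scale_mat_def vec_eq_iff algebra_simps sum.distrib sum_distrib_left)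

lemma matrix_unit_expansion:
  fixes M :: "complex^'n^'n"
  shows "M = (\<Sum>i\<in>UNIV. \<Sum>j\<in>UNIV. scale_mat (M $ i $ j) (matrix_unit i j))"
proof -
  have "(\<Sum>i\<in>UNIV. \<Sum>j\<in>UNIV. M $ i $ j * (if k = i \<and> l = j then 1 else 0)) = M $ k $ l" for k l
  proof -
    have "(\<Sum>j\<in>UNIV. M $ i $ j * (if k = i \<and> l = j then 1 else 0)) =
        (if k = i then M $ k $ l else 0)" for i
      by (cases "k = i") (simp_all add: if_distrib cong: if_cong)
    then show ?thesis by simp
  qed
  then show ?thesis
    by (simp add: vec_eq_iff scale_mat_def matrix_unit_def)
qed

lemma linear_matrix_unit_expansion:
  fixes \<Lambda> :: "complex^'n^'n \<Rightarrow> complex^'m^'m"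
  assumes "Vector_Spaces.linear scale_mat scale_mat \<Lambda>"
  shows "\<Lambda> M = (\<Sum>i\<in>UNIV. \<Sum>j\<in>UNIV. scale_mat (M $ i $ j) (\<Lambda> (matrix_unit i j)))"
proof -
  interpret Vector_Spaces.linear scale_mat scale_mat \<Lambda> by fact
  show ?thesis
    by (subst matrix_unit_expansion [of M]) (simp add: sum scale)
qed

lemma sum_UNIV_prod: "(\<Sum>p\<in>UNIV. h p) = (\<Sum>i\<in>UNIV. \<Sum>j\<in>UNIV. h (i, j))"
  unfolding UNIV_Times_UNIV [symmetric] by (simp add: sum.cartesian_product)

lemma tensor_map_kron:
  assumes "Vector_Spaces.linear scale_mat scale_mat \<Lambda>\<^sub>1"
    and "Vector_Spaces.linear scale_mat scale_mat \<Lambda>\<^sub>2"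
  shows "tensor_map \<Lambda>\<^sub>1 \<Lambda>\<^sub>2 (kron M N) = kron (\<Lambda>\<^sub>1 M) (\<Lambda>\<^sub>2 N)"
proof -
  have "(tensor_map \<Lambda>\<^sub>1 \<Lambda>\<^sub>2 (kron M N)) $ p $ q = kron (\<Lambda>\<^sub>1 M) (\<Lambda>\<^sub>2 N) $ p $ q" for p q
  proof -
    let ?f = "\<lambda>i k. M $ i $ k * \<Lambda>\<^sub>1 (matrix_unit i k) $ fst p $ fst q"
    let ?g = "\<lambda>j l. N $ j $ l * \<Lambda>\<^sub>2 (matrix_unit j l) $ snd p $ snd q"
    have "(tensor_map \<Lambda>\<^sub>1 \<Lambda>\<^sub>2 (kron M N)) $ p $ q =
        (\<Sum>r\<in>UNIV. \<Sum>s\<in>UNIV. ?f (fst r) (fst s) * ?g (snd r) (snd s))"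
      by (simp add: tensor_map_def kron_def scale_mat_def mult_ac)
    also have "\<dots> = (\<Sum>i\<in>UNIV. \<Sum>j\<in>UNIV. \<Sum>k\<in>UNIV. \<Sum>l\<in>UNIV. ?f i k * ?g j l)"
      by (simp add: sum_UNIV_prod)
    also have "\<dots> = (\<Sum>i\<in>UNIV. \<Sum>k\<in>UNIV. ?f i k) * (\<Sum>j\<in>UNIV. \<Sum>l\<in>UNIV. ?g j l)"
      by (simp only: sum_product)
    also have "\<dots> = \<Lambda>\<^sub>1 M $ fst p $ fst q * \<Lambda>\<^sub>2 N $ snd p $ snd q"
      by (simp add: linear_matrix_unit_expansion [OF assms(1), of M]
        linear_matrix_unit_expansion [OF assms(2), of N] scale_mat_def)
    finally show ?thesis by (simp add: kron_def)
  qed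
  then show ?thesis by (simp add: vec_eq_iff)
qed

end

theory Submission
  imports Defs
begin

text \<open>
  With all partial transposes \<open>T\<close> taken on \<open>B'\<close>, every value \<open>Ntilde\<close> on the left is the Rayleigh
  quotient of the partially transposed output \<open>\<Lambda>(|\<psi>\<rangle>\<langle>\<psi>|)\<^sup>T\<close> at a unit eigenvector \<open>v\<close>. By
  the Choi formula it equals \<open>Tr (X C\<^sup>T)\<close> for the pure state
  \<open>X\<close> of \<open>cnj \<psi> \<otimes> v\<close>, which is feasible on the right since its partial transpose is again a pure
  product state. Minimizing the Rayleigh quotient jointly over the two unit spheres shows that
  the left minimum is attained; the right one is attained because the feasible set is compact.
\<close>

definition hermitian :: "complex^'n^'n \<Rightarrow> bool" where
  "hermitian M \<longleftrightarrow> (\<forall>i j. M $ j $ i = cnj (M $ i $ j))"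

definition kron_vec :: "complex^'n \<Rightarrow> complex^'m \<Rightarrow> complex^('n \<times> 'm)" where
  "kron_vec v w = (\<chi> p. v $ fst p * w $ snd p)"

text \<open>Conjugation in the fixed basis: transposing the rank-one matrix of a vector amounts to
  conjugating the vector.\<close>

definition cnj_vec :: "complex^'n \<Rightarrow> complex^'n" where
  "cnj_vec v = (\<chi> i. cnj (v $ i))"

section \<open>Self-adjoint operators and the least eigenvalue\<close>

text \<open>First-order condition at a minimum: the quadratic vanishes at \<open>t = 0\<close> and
  is nowhere negative, so its slope there is zero.\<close>

lemma nonneg_quadratic_zero:
  fixes a b :: real
  assumes "\<And>t. 0 \<le> 2 * t * a + t\<^sup>2 * b"
  shows "a = 0"
proof (rule ccontr)
  assume "a \<noteq> 0"
  \<comment> \<open>The sign opposes the linear term, and the size lets the quadratic term cancel at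
    most half of it; the \<open>+ 1\<close> keeps the denominator positive when
    \<open>b = 0\<close>.\<close>
  define t where "t = - a / (\<bar>b\<bar> + 1)"
  have "2 * t * a + t\<^sup>2 * b \<le> 2 * t * a + t\<^sup>2 * (\<bar>b\<bar> + 1)"
    by (intro add_left_mono mult_left_mono) auto
  also have "\<dots> = t * (2 * a + t * (\<bar>b\<bar> + 1))"
    by (simp add: power2_eq_square algebra_simps)
  also have "t * (\<bar>b\<bar> + 1) = - a"
    by (simp add: t_def)
  also have "t * (2 * a + - a) = - (a\<^sup>2 / (\<bar>b\<bar> + 1))"
    by (simp add: t_def power2_eq_square)
  also have "\<dots> < 0"
    using \<open>a \<noteq> 0\<close> by simp
  finally show False using assms [of t] by simp
qed

text \<open>Compactness of the sphere gives a minimizer \<open>v\<close> of the Rayleigh quotient.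
  With \<open>\<mu>\<close> the minimum, \<open>T - \<mu>\<close> is positive semidefinite and its
  form vanishes at \<open>v\<close>, which forces \<open>v\<close> into its kernel.\<close>

lemma self_adjoint_min_eigenvector:
  fixes T :: "'a::euclidean_space \<Rightarrow> 'a"
  assumes lin: "linear T" and sa: "\<And>x y. x \<bullet> T y = T x \<bullet> y"
  obtains v where "norm v = 1" "T v = (v \<bullet> T v) *\<^sub>R v" "\<And>x. norm x = 1 \<Longrightarrow> v \<bullet> T v \<le> x \<bullet> T x"
proof -
  have ne: "sphere (0::'a) 1 \<noteq> {}" by simp
  have "continuous_on (sphere 0 1) (\<lambda>x. x \<bullet> T x)"
    using lin by (intro continuous_intros linear_continuous_on linear_conv_bounded_linear [THEN iffD1])
  then obtain v where v: "v \<in> sphere 0 1" and min: "\<And>x. x \<in> sphere 0 1 \<Longrightarrow> v \<bullet> T v \<le> x \<bullet> T x"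
    using continuous_attains_inf [OF compact_sphere ne] by blast
  define \<mu> where "\<mu> = v \<bullet> T v"
  define S where "S = (\<lambda>x. T x - \<mu> *\<^sub>R x)"
  have linS: "linear S"
    unfolding S_def using lin by (intro linear_compose_sub linear_scale_self)
  have saS: "x \<bullet> S y = S x \<bullet> y" for x y
    by (simp add: S_def inner_diff_left inner_diff_right sa)
  have nonneg: "0 \<le> x \<bullet> S x" for x
  proof (cases "x = 0")
    case True
    then show ?thesis by simp
  next
    case False
    have "\<mu> \<le> (x /\<^sub>R norm x) \<bullet> T (x /\<^sub>R norm x)"
      unfolding \<mu>_def using False by (intro min) simp
    also have "\<dots> = (x \<bullet> T x) / (norm x)\<^sup>2"
      using lin by (simp add: linear_scale power2_eq_square field_simps)
    finally show ?thesis
      using False by (simp add: S_def inner_diff_right field_simps dot_square_norm)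
  qed
  have vS: "v \<bullet> S v = 0"
    using v by (simp add: S_def inner_diff_right dot_square_norm \<mu>_def)
  \<comment> \<open>The form of \<open>S\<close> is perturbed from \<open>v\<close> in the direction
    \<open>S v\<close>; the first-order term is twice the squared norm of
    \<open>S v\<close>.\<close>
  have "S v \<bullet> S v = 0"
  proof (rule nonneg_quadratic_zero)
    fix t :: real
    have "(v + t *\<^sub>R S v) \<bullet> S (v + t *\<^sub>R S v) = 2 * t * (S v \<bullet> S v) + t\<^sup>2 * (S v \<bullet> S (S v))"
      using vS saS [of v "S v"] linS
      by (simp add: linear_add linear_scale inner_add_left inner_add_right power2_eq_square
        algebra_simps)
    then show "0 \<le> 2 * t * (S v \<bullet> S v) + t\<^sup>2 * (S v \<bullet> S (S v))"
      using nonneg by metis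
  qed
  then have "T v = \<mu> *\<^sub>R v" by (simp add: S_def)
  then have "T v = (v \<bullet> T v) *\<^sub>R v" by (simp only: \<mu>_def)
  with v min show thesis by (intro that [of v]) (simp_all only: mem_sphere_0)
qed

text \<open>Finiteness makes \<open>Min\<close> in \<open>min_eigenvalue\<close> meaningful. One
  eigenvector per eigenvalue gives an injective, pairwise orthogonal family, hence a finite
  one.\<close>

lemma self_adjoint_finite_eigenvalues:
  fixes T :: "'a::euclidean_space \<Rightarrow> 'a"
  assumes sa: "\<And>x y. x \<bullet> T y = T x \<bullet> y"
  shows "finite {\<mu>. \<exists>v. v \<noteq> 0 \<and> T v = \<mu> *\<^sub>R v}" (is "finite ?E")
proof -
  have "\<forall>\<mu>\<in>?E. \<exists>v. v \<noteq> 0 \<and> T v = \<mu> *\<^sub>R v" by blast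
  from bchoice [OF this] obtain e where e: "\<forall>\<mu>\<in>?E. e \<mu> \<noteq> 0 \<and> T (e \<mu>) = \<mu> *\<^sub>R e \<mu>" ..
  have orth: "e \<mu> \<bullet> e \<nu> = 0" if "\<mu> \<in> ?E" "\<nu> \<in> ?E" "\<mu> \<noteq> \<nu>" for \<mu> \<nu>
    using sa [of "e \<mu>" "e \<nu>"] bspec [OF e that(1)] bspec [OF e that(2)] that(3) by simp
  have "inj_on e ?E"
  proof (rule inj_onI, rule ccontr)
    fix \<mu> \<nu> assume *: "\<mu> \<in> ?E" "\<nu> \<in> ?E" "e \<mu> = e \<nu>" "\<mu> \<noteq> \<nu>"
    then show False using orth [OF *(1,2,4)] bspec [OF e *(1)] by simp
  qed
  moreover have "finite (e ` ?E)"
    by (rule pairwise_orthogonal_imp_finite)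
      (auto simp only: pairwise_def orthogonal_def intro: orth)
  ultimately show ?thesis by (simp only: finite_image_iff)
qed

text \<open>Bridge from the underlying real Euclidean space, where the spectral lemmas live, to the
  complex form.\<close>

lemma inner_eq_Re_cinner: "v \<bullet> w = Re (cinner v w)"
  by (simp add: inner_vec_def cinner_def inner_complex_def)

lemma hermitian_self_adjoint:
  assumes "hermitian M"
  shows "v \<bullet> (M *v w) = (M *v v) \<bullet> w"
proof -
  have "cinner v (M *v w) = (\<Sum>i\<in>UNIV. \<Sum>j\<in>UNIV. cnj (v $ i) * (M $ i $ j * w $ j))"
    by (simp add: cinner_def matrix_vector_mult_def sum_distrib_left)
  also have "\<dots> = (\<Sum>j\<in>UNIV. \<Sum>i\<in>UNIV. cnj (v $ i) * (M $ i $ j * w $ j))"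
    by (rule sum.swap)
  also have "\<dots> = (\<Sum>j\<in>UNIV. \<Sum>i\<in>UNIV. cnj (M $ j $ i * v $ i) * w $ j)"
  proof (intro sum.cong refl)
    fix i j
    have "cnj (M $ j $ i) = M $ i $ j"
      using assms by (metis hermitian_def)
    then show "cnj (v $ i) * (M $ i $ j * w $ j) = cnj (M $ j $ i * v $ i) * w $ j"
      by simp
  qed
  also have "\<dots> = cinner (M *v v) w"
    by (simp add: cinner_def matrix_vector_mult_def sum_distrib_right)
  finally show ?thesis by (simp add: inner_eq_Re_cinner)
qed

lemma of_real_vector_scalar_mult: "complex_of_real x *s v = x *\<^sub>R v"
  by (simp add: vec_eq_iff scaleR_conv_of_real [where 'a = complex])

text \<open>On the underlying real space \<open>M\<close> acts as a self-adjoint map whose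
  eigenvalues are exactly those collected in \<open>min_eigenvalue\<close>, so the Rayleigh
  minimizer is an eigenvector for the least of them.\<close>

lemma hermitian_min_eigenvalue:
  assumes "hermitian M"
  obtains v where "norm v = 1" "min_eigenvalue M = Re (cinner v (M *v v))"
    "\<And>x. norm x = 1 \<Longrightarrow> min_eigenvalue M \<le> Re (cinner x (M *v x))"
proof -
  let ?T = "\<lambda>v. M *v v"
  let ?E = "{\<mu>. \<exists>v. v \<noteq> 0 \<and> ?T v = \<mu> *\<^sub>R v}"
  have sa: "x \<bullet> ?T y = ?T x \<bullet> y" for x y
    by (rule hermitian_self_adjoint [OF assms])
  have lin: "linear ?T"
    by (intro linearI) (simp_all add: vec_eq_iff matrix_vector_mult_def sum.distrib
      distrib_left scaleR_sum_right)
  obtain v where v: "norm v = 1" "?T v = (v \<bullet> ?T v) *\<^sub>R v"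
    and min: "\<And>x. norm x = 1 \<Longrightarrow> v \<bullet> ?T v \<le> x \<bullet> ?T x"
    using self_adjoint_min_eigenvector [OF lin sa] by blast
  have "Min ?E = v \<bullet> ?T v"
  proof (rule Min_eqI [OF self_adjoint_finite_eigenvalues [OF sa]])
    show "v \<bullet> ?T v \<in> ?E" using v by (metis (mono_tags, lifting) mem_Collect_eq norm_zero zero_neq_one)
  next
    fix \<mu> assume "\<mu> \<in> ?E"
    then obtain x where x: "x \<noteq> 0" "?T x = \<mu> *\<^sub>R x" by blast
    define y where "y = x /\<^sub>R norm x"
    have y: "norm y = 1" using x by (simp add: y_def)
    have Ty: "?T y = \<mu> *\<^sub>R y"
      unfolding y_def linear_scale [OF lin] x(2) by (simp add: mult.commute)
    have "v \<bullet> ?T v \<le> y \<bullet> ?T y"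
      using y by (rule min)
    also have "\<dots> = \<mu>"
      unfolding Ty using y by (simp add: dot_square_norm)
    finally show "v \<bullet> ?T v \<le> \<mu>" .
  qed
  then have "min_eigenvalue M = v \<bullet> ?T v"
    by (simp add: min_eigenvalue_def of_real_vector_scalar_mult)
  with v(1) min show thesis
    by (intro that [of v]) (simp_all add: inner_eq_Re_cinner)
qed

section \<open>Positive semidefinite matrices\<close>

text \<open>The form of the matrix with rows \<open>a b\<close> and \<open>c d\<close> is tested on
  a few vectors. The last bound is a linear substitute for the determinant condition.\<close>

lemma nonneg_form_2:
  fixes a b c d :: complex
  assumes "\<And>x y. cnj x * a * x + cnj x * b * y + cnj y * c * x + cnj y * d * y \<in> \<real>\<^sub>\<ge>\<^sub>0"
  shows "0 \<le> Re a" and "c = cnj b" and "2 * norm b \<le> Re a + Re d"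
proof -
  have "a \<in> \<real>\<^sub>\<ge>\<^sub>0" using assms [of 1 0] by simp
  then have a: "0 \<le> Re a" "Im a = 0" by (simp_all add: complex_nonneg_Reals_iff)
  have "d \<in> \<real>\<^sub>\<ge>\<^sub>0" using assms [of 0 1] by simp
  then have d: "0 \<le> Re d" "Im d = 0" by (simp_all add: complex_nonneg_Reals_iff)
  show "0 \<le> Re a" by fact
  \<comment> \<open>The vectors (1, 1) and (1, i) make b + c and i (b - c) real.\<close>
  show c: "c = cnj b"
    using assms [of 1 1] assms [of 1 \<i>] a d
    by (auto simp: complex_nonneg_Reals_iff complex_eq_iff)
  show "2 * norm b \<le> Re a + Re d"
  proof (cases "b = 0")
    case True
    then show ?thesis using a d by simp
  next
    case False
    \<comment> \<open>The phase that turns both off-diagonal terms into \<open>- norm b\<close>, so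
      that the vector (1, u) gives the bound.\<close>
    define u where "u = - cnj b / norm b"
    have "norm u = 1"
      using False by (simp add: u_def norm_divide)
    then have u: "cnj u * u = 1" "b * u = - norm b"
      using False complex_norm_square [of u] complex_norm_square [of b]
      by (simp_all add: u_def mult.commute power2_eq_square)
    have dd: "cnj u * d * u = d"
      using u(1) by (metis mult.assoc mult.commute mult.left_neutral)
    have cc: "cnj u * c = - norm b"
      using arg_cong [OF u(2), of cnj] c by (simp add: mult.commute)
    have "a + b * u + cnj u * c + cnj u * d * u \<in> \<real>\<^sub>\<ge>\<^sub>0"
      using assms [of 1 u] by simp
    then have "a + - norm b + - norm b + d \<in> \<real>\<^sub>\<ge>\<^sub>0"
      unfolding dd cc u(2) .
    then show ?thesis
      by (simp add: complex_nonneg_Reals_iff)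
  qed
qed

lemma cinner_axis_left: "cinner (axis i x) w = cnj x * w $ i"
  by (simp add: cinner_def axis_def if_distrib [of cnj] if_distrib [of "\<lambda>z. z * _"] cong: if_cong)

lemma cinner_add_left: "cinner (u + v) w = cinner u w + cinner v w"
  by (simp add: cinner_def sum.distrib algebra_simps)

lemma matrix_vector_mult_axis: "(M *v axis j y) $ i = M $ i $ j * (y::complex)"
  by (simp add: matrix_vector_mult_def axis_def if_distrib [of "\<lambda>z. _ * z"] cong: if_cong)

text \<open>Restricting the form to vectors \<open>axis i x + axis j y\<close> leaves a form in
  \<open>x\<close> and \<open>y\<close>, also when \<open>i = j\<close>.\<close>

lemma psd_entries:
  assumes "psd M"
  shows "0 \<le> Re (M $ i $ i)" and "2 * norm (M $ i $ j) \<le> Re (M $ i $ i) + Re (M $ j $ j)"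
proof -
  have form: "cnj x * M $ i $ i * x + cnj x * M $ i $ j * y + cnj y * M $ j $ i * x +
      cnj y * M $ j $ j * y \<in> \<real>\<^sub>\<ge>\<^sub>0" for x y
  proof -
    have "cinner (axis i x + axis j y) (M *v (axis i x + axis j y)) =
        cnj x * M $ i $ i * x + cnj x * M $ i $ j * y + cnj y * M $ j $ i * x +
        cnj y * M $ j $ j * y"
      by (simp add: cinner_add_left cinner_axis_left matrix_vector_right_distrib
        matrix_vector_mult_axis algebra_simps)
    with assms show ?thesis by (metis psd_def)
  qed
  show "0 \<le> Re (M $ i $ i)" by (rule nonneg_form_2(1) [OF form])
  show "2 * norm (M $ i $ j) \<le> Re (M $ i $ i) + Re (M $ j $ j)"
    by (rule nonneg_form_2(3) [OF form])
qed

text \<open>The diagonal is nonnegative with sum 1, and every entry is at most the mean of two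
  diagonal entries in modulus.\<close>

lemma density_matrix_entry_bound:
  fixes M :: "complex^'n^'n"
  assumes "density_matrix M"
  shows "norm (M $ i $ j) \<le> 1"
proof -
  have psd: "psd M" and tr: "trace M = 1"
    using assms by (simp_all add: density_matrix_def)
  have "Re (M $ k $ k) \<le> (\<Sum>l\<in>UNIV. Re (M $ l $ l))" for k
    using psd_entries(1) [OF psd] by (intro member_le_sum) auto
  moreover have "(\<Sum>l\<in>UNIV. Re (M $ l $ l)) = 1"
    using arg_cong [OF tr, of Re] by (simp add: trace_def)
  ultimately show ?thesis
    using psd_entries(2) [OF psd, of i j] by (smt (verit))
qed

lemma continuous_on_cinner_matrix [continuous_intros]:
  assumes "continuous_on S v" "continuous_on S w" "continuous_on S A"
  shows "continuous_on S (\<lambda>x. cinner (v x) (A x *v w x))"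
  unfolding cinner_def matrix_vector_mult_def vec_lambda_beta
  using assms by (intro continuous_intros)

lemma continuous_on_ptranspose: "continuous_on S ptranspose"
  unfolding ptranspose_def by (intro continuous_intros)

lemma closed_psd: "closed {M :: complex^'n^'n. psd M}"
proof -
  have "closed ((\<lambda>M :: complex^'n^'n. cinner v (M *v v)) -` \<real>\<^sub>\<ge>\<^sub>0)" for v
    by (intro closed_vimage closed_nonneg_Reals_complex continuous_intros)
  moreover have "{M :: complex^'n^'n. psd M} = (\<Inter>v. (\<lambda>M. cinner v (M *v v)) -` \<real>\<^sub>\<ge>\<^sub>0)"
    by (auto simp: psd_def)
  ultimately show ?thesis by (simp add: closed_INT)
qed

text \<open>Applied with AB and A'B' as the two factors, so that \<open>ptranspose\<close> is the
  transpose on A'B'.\<close>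

lemma compact_ppt_states:
  "compact {X :: complex^('n::finite \<times> 'm::finite)^('n \<times> 'm). density_matrix X \<and> psd (ptranspose X)}"
    (is "compact ?F")
proof -
  have "?F = {X. psd X} \<inter> {X. trace X = 1} \<inter> ptranspose -` {X. psd X}"
    by (auto simp: density_matrix_def)
  moreover have "closed {X :: complex^('n \<times> 'm)^('n \<times> 'm). trace X = 1}"
    unfolding trace_def by (intro closed_Collect_eq continuous_intros)
  ultimately have "closed ?F"
    by (simp only:) (intro closed_Int closed_psd closed_vimage continuous_on_ptranspose)
  moreover have "bounded ?F"
  proof (rule boundedI)
    fix X :: "complex^('n \<times> 'm)^('n \<times> 'm)" assume "X \<in> ?F"
    then have le: "norm (X $ i $ j) \<le> 1" for i j
      by (simp add: density_matrix_entry_bound)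
    have row: "norm (X $ i) \<le> real CARD('n \<times> 'm)" for i
    proof -
      have "norm (X $ i) \<le> (\<Sum>j\<in>UNIV. norm (X $ i $ j))"
        unfolding norm_vec_def [of "X $ i"] by (rule L2_set_le_sum) simp
      also have "\<dots> \<le> real CARD('n \<times> 'm) * 1"
        using le by (intro sum_bounded_above) simp
      finally show ?thesis by simp
    qed
    have "norm X \<le> (\<Sum>i\<in>UNIV. norm (X $ i))"
      unfolding norm_vec_def [of X] by (rule L2_set_le_sum) simp
    also have "\<dots> \<le> real CARD('n \<times> 'm) * real CARD('n \<times> 'm)"
      using row by (intro sum_bounded_above) simp
    finally show "norm X \<le> real CARD('n \<times> 'm) * real CARD('n \<times> 'm)" .
  qed
  ultimately show ?thesis by (simp add: compact_eq_bounded_closed)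
qed

section \<open>Pure product states\<close>

lemma trace_pure_state: "trace (pure_state w) = of_real ((norm w)\<^sup>2)"
proof -
  have "trace (pure_state w) = (\<Sum>i\<in>UNIV. of_real ((norm (w $ i))\<^sup>2))"
    unfolding trace_def pure_state_def
    by (simp only: vec_lambda_beta complex_norm_square)
  then show ?thesis
    by (simp add: norm_vec_def L2_set_def sum_nonneg)
qed

lemma psd_pure_state: "psd (pure_state w)"
  unfolding psd_def
proof
  fix u
  have "cinner u (pure_state w *v u) =
      (\<Sum>i\<in>UNIV. cnj (u $ i) * w $ i) * (\<Sum>j\<in>UNIV. cnj (w $ j) * u $ j)"
    by (simp add: cinner_def matrix_vector_mult_def pure_state_def sum_product sum_distrib_left
      mult_ac)
  also have "\<dots> = cnj (cinner w u) * cinner w u"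
    by (simp add: cinner_def mult_ac)
  also have "\<dots> = of_real ((norm (cinner w u))\<^sup>2)"
    by (simp only: complex_norm_square mult.commute)
  finally show "cinner u (pure_state w *v u) \<in> \<real>\<^sub>\<ge>\<^sub>0" by simp
qed

lemma norm_kron_vec: "norm (kron_vec v w) = norm v * norm w"
proof -
  have "(\<Sum>p\<in>UNIV. (norm (kron_vec v w $ p))\<^sup>2) =
      (\<Sum>i\<in>UNIV. (norm (v $ i))\<^sup>2) * (\<Sum>j\<in>UNIV. (norm (w $ j))\<^sup>2)"
    by (simp add: sum_UNIV_prod kron_vec_def norm_mult power_mult_distrib sum_product)
  then show ?thesis
    by (simp add: norm_vec_def L2_set_def real_sqrt_mult)
qed

lemma norm_cnj_vec: "norm (cnj_vec v) = norm v"
  by (simp add: norm_vec_def cnj_vec_def)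

lemma ptranspose_pure_state_kron:
  "ptranspose (pure_state (kron_vec v w)) = pure_state (kron_vec v (cnj_vec w))"
  by (simp add: ptranspose_def pure_state_def kron_vec_def cnj_vec_def vec_eq_iff mult_ac)

lemma product_state_feasible:
  assumes "norm v = 1" "norm w = 1"
  shows "density_matrix (pure_state (kron_vec v w))" "psd (ptranspose (pure_state (kron_vec v w)))"
  using assms
  by (simp_all add: density_matrix_def psd_pure_state trace_pure_state norm_kron_vec
    ptranspose_pure_state_kron)

lemma trace_pure_state_mult: "trace (pure_state w ** D) = cinner w (D *v w)"
proof -
  have "trace (pure_state w ** D) = (\<Sum>i\<in>UNIV. \<Sum>j\<in>UNIV. w $ i * cnj (w $ j) * D $ j $ i)"
    by (simp add: trace_def matrix_matrix_mult_def pure_state_def)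
  also have "\<dots> = (\<Sum>j\<in>UNIV. \<Sum>i\<in>UNIV. w $ i * cnj (w $ j) * D $ j $ i)"
    by (rule sum.swap)
  finally show ?thesis
    by (simp add: cinner_def matrix_vector_mult_def sum_distrib_left mult_ac)
qed

section \<open>The Choi matrix\<close>

lemma choi_entry: "choi \<Lambda> $ p $ q = \<Lambda> (matrix_unit (fst p) (fst q)) $ snd p $ snd q"
proof -
  have "choi \<Lambda> $ p $ q = (\<Sum>i\<in>UNIV. \<Sum>j\<in>UNIV.
      if fst p = i \<and> fst q = j then \<Lambda> (matrix_unit i j) $ snd p $ snd q else 0)"
    by (auto simp: choi_def kron_def matrix_unit_def intro!: sum.cong)
  also have "\<dots> = (\<Sum>i\<in>UNIV. if fst p = i then
      (\<Sum>j\<in>UNIV. if fst q = j then \<Lambda> (matrix_unit i j) $ snd p $ snd q else 0) else 0)"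
    by (intro sum.cong) auto
  finally show ?thesis by simp
qed

text \<open>The Choi formula at a pure state: conjugating \<open>\<psi>\<close> supplies the
  transpose of the input, and transposing B' in the Choi matrix transposes B' in the output, since
  the trace over AB leaves the output indices alone.\<close>

lemma choi_expectation:
  fixes \<Lambda> :: "complex^'n^'n \<Rightarrow> complex^('c::finite \<times> 'd::finite)^('c \<times> 'd)"
  assumes "Vector_Spaces.linear scale_mat scale_mat \<Lambda>"
  shows "trace (pure_state (kron_vec (cnj_vec \<psi>) v) ** ptranspose_last (choi \<Lambda>)) =
    cinner v (ptranspose (\<Lambda> (pure_state \<psi>)) *v v)"
proof -
  let ?D = "\<lambda>p m q m'. \<Lambda> (matrix_unit p q) $ (fst m, snd m') $ (fst m', snd m)"
  let ?t = "\<lambda>p m q m'. \<psi> $ p * cnj (\<psi> $ q) * cnj (v $ m) * v $ m' * ?D p m q m'"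
  have "trace (pure_state (kron_vec (cnj_vec \<psi>) v) ** ptranspose_last (choi \<Lambda>)) =
      (\<Sum>p\<in>UNIV. \<Sum>m\<in>UNIV. \<Sum>q\<in>UNIV. \<Sum>m'\<in>UNIV. ?t p m q m')"
    unfolding trace_pure_state_mult cinner_def matrix_vector_mult_def
    \<comment> \<open>The type of \<open>h\<close> restricts the splitting to the pairs (AB, A'B'),
      keeping sums over A'B' whole.\<close>
    by (simp only: sum_UNIV_prod [where h = "h :: 'n \<times> ('c \<times> 'd) \<Rightarrow> complex" for h] sum_distrib_left
      vec_lambda_beta)
      (simp add: kron_vec_def cnj_vec_def ptranspose_last_def choi_entry mult_ac)
  \<comment> \<open>The input indices \<open>p\<close>, \<open>q\<close> move inside, where they
    form the matrix-unit expansion of the output.\<close>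
  also have "\<dots> = (\<Sum>m\<in>UNIV. \<Sum>p\<in>UNIV. \<Sum>m'\<in>UNIV. \<Sum>q\<in>UNIV. ?t p m q m')"
    by (subst sum.swap) (intro sum.cong refl sum.swap)
  also have "\<dots> = (\<Sum>m\<in>UNIV. \<Sum>m'\<in>UNIV. \<Sum>p\<in>UNIV. \<Sum>q\<in>UNIV. ?t p m q m')"
    by (intro sum.cong refl sum.swap)
  also have "\<dots> = cinner v (ptranspose (\<Lambda> (pure_state \<psi>)) *v v)"
    by (simp add: cinner_def matrix_vector_mult_def ptranspose_def
      linear_matrix_unit_expansion [OF assms, of "pure_state \<psi>"])
      (simp add: scale_mat_def pure_state_def sum_distrib_left sum_distrib_right mult_ac)
  finally show ?thesis .
qed

section \<open>Hermiticity\<close>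

text \<open>Apply \<open>\<Lambda>\<close> blockwise to the rank-one \<open>2\<times>2\<close> block matrix \<open>w w\<^sup>*\<close> with \<open>w = e\<^sub>i \<oplus> e\<^sub>j\<close>.\<close>

lemma completely_positive_matrix_unit:
  fixes \<Lambda> :: "complex^'n^'n \<Rightarrow> complex^'m^'m"
  assumes "completely_positive \<Lambda>"
  shows "\<Lambda> (matrix_unit j i) $ l $ k = cnj (\<Lambda> (matrix_unit i j) $ k $ l)"
proof -
  define s where "s = (\<lambda>a::nat. if a = 0 then i else j)"
  have unit: "cinner u (matrix_unit p q *v w) = cnj (u $ p) * w $ q" for u w p q
  proof -
    have "matrix_unit p q *v w = axis p (w $ q)"
      by (simp add: vec_eq_iff matrix_vector_mult_def matrix_unit_def axis_def
        if_distrib [of "\<lambda>z. z * _"] cong: if_cong)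
    then show ?thesis
      by (simp add: cinner_def axis_def if_distrib [of "\<lambda>z. _ * z"] cong: if_cong)
  qed
  have "block_psd 2 (\<lambda>a b. matrix_unit (s a) (s b))"
    unfolding block_psd_def
  proof
    fix v :: "nat \<Rightarrow> complex^'n"
    have "(\<Sum>a<2. \<Sum>b<2. cinner (v a) (matrix_unit (s a) (s b) *v v b)) =
        cnj (\<Sum>a<2. v a $ s a) * (\<Sum>b<2. v b $ s b)"
      by (simp only: unit sum_product cnj_sum)
    also have "\<dots> = of_real ((norm (\<Sum>a<2. v a $ s a))\<^sup>2)"
      by (simp only: complex_norm_square mult.commute)
    finally show "(\<Sum>a<2. \<Sum>b<2. cinner (v a) (matrix_unit (s a) (s b) *v v b)) \<in> \<real>\<^sub>\<ge>\<^sub>0"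
      by simp
  qed
  with assms have psd: "block_psd 2 (\<lambda>a b. \<Lambda> (matrix_unit (s a) (s b)))"
    unfolding completely_positive_def by blast
  \<comment> \<open>Block vectors with components \<open>axis k x\<close> and
    \<open>axis l y\<close> cut out a 2 by 2 form whose off-diagonal entries are the two to be
    compared.\<close>
  show ?thesis
  proof (rule nonneg_form_2(2))
    fix x y
    show "cnj x * \<Lambda> (matrix_unit i i) $ k $ k * x + cnj x * \<Lambda> (matrix_unit i j) $ k $ l * y +
        cnj y * \<Lambda> (matrix_unit j i) $ l $ k * x + cnj y * \<Lambda> (matrix_unit j j) $ l $ l * y
        \<in> \<real>\<^sub>\<ge>\<^sub>0"
      using psd [unfolded block_psd_def, rule_format,
          of "\<lambda>a. if a = 0 then axis k x else axis l y"]
      by (simp add: eval_nat_numeral s_def cinner_axis_left matrix_vector_mult_axis algebra_simps)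
  qed
qed

text \<open>Both factors send adjoint matrix units to adjoint matrices, so exchanging
  \<open>p\<close> and \<open>q\<close> conjugates each term of the output; partial transposition
  keeps Hermiticity.\<close>

lemma hermitian_ptranspose_tensor_map:
  assumes "completely_positive \<Lambda>\<^sub>1" "completely_positive \<Lambda>\<^sub>2"
  shows "hermitian (ptranspose (tensor_map \<Lambda>\<^sub>1 \<Lambda>\<^sub>2 (pure_state \<psi>)))"
proof -
  have "tensor_map \<Lambda>\<^sub>1 \<Lambda>\<^sub>2 (pure_state \<psi>) $ m' $ m =
      cnj (tensor_map \<Lambda>\<^sub>1 \<Lambda>\<^sub>2 (pure_state \<psi>) $ m $ m')" for m m'
  proof -
    let ?t = "\<lambda>p q m m'. \<psi> $ p * cnj (\<psi> $ q) *
      (\<Lambda>\<^sub>1 (matrix_unit (fst p) (fst q)) $ fst m $ fst m' *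
       \<Lambda>\<^sub>2 (matrix_unit (snd p) (snd q)) $ snd m $ snd m')"
    have entry: "tensor_map \<Lambda>\<^sub>1 \<Lambda>\<^sub>2 (pure_state \<psi>) $ m $ m' = (\<Sum>p\<in>UNIV. \<Sum>q\<in>UNIV. ?t p q m m')"
      for m m'
      by (simp add: tensor_map_def pure_state_def scale_mat_def kron_def)
    have swap: "?t q p m' m = cnj (?t p q m m')" for p q
      using completely_positive_matrix_unit [OF assms(1), of "fst q" "fst p" "fst m'" "fst m"]
        completely_positive_matrix_unit [OF assms(2), of "snd q" "snd p" "snd m'" "snd m"]
      by simp
    have "(\<Sum>p\<in>UNIV. \<Sum>q\<in>UNIV. ?t p q m' m) = (\<Sum>q\<in>UNIV. \<Sum>p\<in>UNIV. ?t p q m' m)"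
      by (rule sum.swap)
    then show ?thesis
      by (simp only: entry swap cnj_sum)
  qed
  then show ?thesis
    unfolding hermitian_def ptranspose_def vec_lambda_beta by blast
qed

section \<open>Attainment and comparison of the two minima\<close>

theorem proposition5:
  fixes \<Lambda>\<^sub>1 :: "complex^'a^'a \<Rightarrow> complex^'c^'c"
    and \<Lambda>\<^sub>2 :: "complex^'b^'b \<Rightarrow> complex^'d^'d"
  assumes "quantum_channel \<Lambda>\<^sub>1" and "quantum_channel \<Lambda>\<^sub>2"
  shows "let C = choi (tensor_map \<Lambda>\<^sub>1 \<Lambda>\<^sub>2);
             f = (\<lambda>\<psi>. Ntilde (tensor_map \<Lambda>\<^sub>1 \<Lambda>\<^sub>2 (pure_state \<psi>)));
             g = (\<lambda>X. Re (trace (X ** ptranspose_last C)))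
         in \<exists>\<psi> X. is_arg_min f (\<lambda>\<psi>. norm \<psi> = 1) \<psi> \<and>
                  is_arg_min g (\<lambda>X. density_matrix X \<and> psd (ptranspose X)) X \<and>
                  f \<psi> \<ge> g X"
proof -
  define \<Lambda> where "\<Lambda> = tensor_map \<Lambda>\<^sub>1 \<Lambda>\<^sub>2"
  define f where "f = (\<lambda>\<psi>. Ntilde (\<Lambda> (pure_state \<psi>)))"
  \<comment> \<open>On density matrices the trace is already real, both factors being Hermitian;
    \<open>Re\<close> only changes the type.\<close>
  define g where "g = (\<lambda>X. Re (trace (X ** ptranspose_last (choi \<Lambda>))))"
  define X where "X = (\<lambda>\<psi> v. pure_state (kron_vec (cnj_vec \<psi>) v)
    :: complex^(('a \<times> 'b) \<times> ('c \<times> 'd))^(('a \<times> 'b) \<times> ('c \<times> 'd)))"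
  let ?F = "{X. density_matrix X \<and> psd (ptranspose X)}
    :: (complex^(('a \<times> 'b) \<times> ('c \<times> 'd))^(('a \<times> 'b) \<times> ('c \<times> 'd))) set"
  let ?S = "sphere 0 1 :: (complex^('a \<times> 'b)) set" and ?S' = "sphere 0 1 :: (complex^('c \<times> 'd)) set"
  have herm: "hermitian (ptranspose (\<Lambda> (pure_state \<psi>)))" for \<psi>
    unfolding \<Lambda>_def using assms
    by (intro hermitian_ptranspose_tensor_map) (simp_all add: quantum_channel_def)
  have g_X: "g (X \<psi> v) = Re (cinner v (ptranspose (\<Lambda> (pure_state \<psi>)) *v v))" for \<psi> v
    unfolding g_def X_def \<Lambda>_def by (simp add: choi_expectation [OF linear_tensor_map])
  have f_le: "f \<psi> \<le> g (X \<psi> v)" if "norm v = 1" for \<psi> v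
    unfolding g_X using that by (metis herm hermitian_min_eigenvalue f_def Ntilde_def)
  have f_eq: "\<exists>v. norm v = 1 \<and> f \<psi> = g (X \<psi> v)" for \<psi>
    unfolding g_X by (metis herm hermitian_min_eigenvalue f_def Ntilde_def)
  have feasible: "X \<psi> v \<in> ?F" if "norm \<psi> = 1" "norm v = 1" for \<psi> v
    using that by (simp add: X_def product_state_feasible norm_cnj_vec)
  have cont_g: "continuous_on S g" for S
    unfolding g_def trace_def matrix_matrix_mult_def vec_lambda_beta by (intro continuous_intros)
  have cont_X: "continuous_on S (\<lambda>p. X (fst p) (snd p))" for S
    unfolding X_def pure_state_def kron_vec_def cnj_vec_def vec_lambda_beta
    by (intro continuous_intros)
  have cont: "continuous_on S (\<lambda>p. g (X (fst p) (snd p)))" for S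
    by (rule continuous_on_compose2 [OF cont_g [of UNIV] cont_X]) simp
  have "compact (?S \<times> ?S')" "?S \<times> ?S' \<noteq> {}"
    by (simp_all add: compact_Times)
  from continuous_attains_inf [OF this cont] obtain p where p: "p \<in> ?S \<times> ?S'"
    and p_min: "\<And>q. q \<in> ?S \<times> ?S' \<Longrightarrow> g (X (fst p) (snd p)) \<le> g (X (fst q) (snd q))"
    by blast
  define \<psi> where "\<psi> = fst p"
  have \<psi>: "norm \<psi> = 1" using p by (auto simp: \<psi>_def)
  \<comment> \<open>\<open>f \<phi>\<close> is itself a value of the jointly minimized function, at
    an eigenvector \<open>v\<close>, while the joint minimum bounds \<open>f \<psi>\<close> from
    above.\<close>
  have f_min: "f \<psi> \<le> f \<phi>" if \<phi>: "norm \<phi> = 1" for \<phi>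
  proof -
    obtain v where v: "norm v = 1" "f \<phi> = g (X \<phi> v)" using f_eq by blast
    have "f \<psi> \<le> g (X \<psi> (snd p))" using p by (intro f_le) auto
    also have "\<dots> \<le> f \<phi>" using p_min [of "(\<phi>, v)"] \<phi> v by (simp add: \<psi>_def)
    finally show ?thesis .
  qed
  \<comment> \<open>The resulting product state serves twice: it shows that the feasible set is
    nonempty, and its value \<open>f \<psi>\<close> bounds the right minimum.\<close>
  obtain v where v: "norm v = 1" "f \<psi> = g (X \<psi> v)" using f_eq by blast
  have "?F \<noteq> {}" using feasible [OF \<psi> v(1)] by blast
  from continuous_attains_inf [OF compact_ppt_states this cont_g]
  obtain Y where Y: "Y \<in> ?F" and Y_min: "\<And>Z. Z \<in> ?F \<Longrightarrow> g Y \<le> g Z"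
    by (elim bexE) blast
  have "is_arg_min f (\<lambda>\<psi>. norm \<psi> = 1) \<psi>"
    using \<psi> f_min by (simp add: is_arg_min_linorder)
  moreover have "is_arg_min g (\<lambda>X. density_matrix X \<and> psd (ptranspose X)) Y"
    using Y Y_min by (simp add: is_arg_min_linorder)
  moreover have "g Y \<le> f \<psi>"
    using Y_min [OF feasible [OF \<psi> v(1)]] v(2) by simp
  ultimately show ?thesis
    unfolding Let_def f_def g_def \<Lambda>_def by blast
qed

end
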